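(* For $k\ge 0$ let $L_k$ be the $2^k\times 2^k$ Latin square defined by $L_0=(1)$ and $L_k=\begin{pmatrix} L_{k-1}+2^{k-1} & L_{k-1}\\ L_{k-1} & L_{k-1}+2^{k-1}\end{pmatrix}$ for $k\ge1$ (equivalently, the $k$-fold tensor product of $\begin{pmatrix}2&1\\1&2\end{pmatrix}$). Then, with $n=2^k$, $(L_k,\mathrm{lex})$ contains a greedy defining set of cardinality $n^2-\Omega(n^{1.673})$ (as $k\to\infty$).
   Context: For a Latin square $L$ on $\{1,\ldots,n\}$ and an integer $p$, $L+p$ is obtained by adding $p$ to every entry. A Latin square of order $n$ with entries in $\{1,\ldots,n\}$ is regarded as a proper coloring of $K_n\Box K_n$ (cells are vertices; two cells are adjacent iff they share a row or column), with cells ordered lexicographically (row by row, top to bottom, each row left to right). First-Fit subject to a pre-coloring of a set $S$ of cells: cells of $S$ keep their given values; other cells are scanned in order and each gets the smallest positive integer not used on its already colored neighbors (cells of $S$ count as colored from the start). $S$ is a greedy defining set of $(L,\mathrm{lex})$ if First-Fit subject to the entries of $L$ on $S$ reproduces $L$. *)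

theory Defs
  imports Complex_Main "HOL-Library.Landau_Symbols"
begin

text \<open>Rows and columns are indexed by \<open>0, \<dots>, n - 1\<close>; entries are \<open>1, \<dots>, n\<close>.\<close>

type_synonym cell = "nat \<times> nat"

definition cells :: "nat \<Rightarrow> cell set" where
  "cells n = {..<n} \<times> {..<n}"

definition latin_square :: "nat \<Rightarrow> (cell \<Rightarrow> nat) \<Rightarrow> bool" where
  "latin_square n L \<longleftrightarrow>
     (\<forall>i<n. bij_betw (\<lambda>j. L (i, j)) {..<n} {1..n}) \<and>
     (\<forall>j<n. bij_betw (\<lambda>i. L (i, j)) {..<n} {1..n})"

definition rook_adj :: "cell \<Rightarrow> cell \<Rightarrow> bool" where
  "rook_adj u v \<longleftrightarrow> u \<noteq> v \<and> (fst u = fst v \<or> snd u = snd v)"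

definition lex_cells :: "nat \<Rightarrow> cell list" where
  "lex_cells n = List.product [0..<n] [0..<n]"

text \<open>Partial colorings are maps; the domain is the set of cells colored so far.\<close>

definition first_fit_color :: "('v \<Rightarrow> 'v \<Rightarrow> bool) \<Rightarrow> ('v \<rightharpoonup> nat) \<Rightarrow> 'v \<Rightarrow> nat" where
  "first_fit_color adj f v = (LEAST c. 1 \<le> c \<and> (\<forall>u\<in>dom f. adj u v \<longrightarrow> f u \<noteq> Some c))"

definition first_fit :: "('v \<Rightarrow> 'v \<Rightarrow> bool) \<Rightarrow> 'v list \<Rightarrow> ('v \<rightharpoonup> nat) \<Rightarrow> ('v \<rightharpoonup> nat)" where
  "first_fit adj vs p =
     fold (\<lambda>v f. if v \<in> dom p then f else f(v \<mapsto> first_fit_color adj f v)) vs p"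

definition greedy_defining_set_lex :: "nat \<Rightarrow> (cell \<Rightarrow> nat) \<Rightarrow> cell set \<Rightarrow> bool" where
  "greedy_defining_set_lex n L S \<longleftrightarrow>
     S \<subseteq> cells n \<and>
     (\<forall>v\<in>cells n. first_fit rook_adj (lex_cells n) ((Some \<circ> L) |` S) v = Some (L v))"

text \<open>Only the values on \<open>cells (2 ^ k)\<close> are meaningful; in the recursion,
  \<open>i mod 2 ^ k\<close> and \<open>j mod 2 ^ k\<close> are the coordinates inside a block.\<close>

fun tensor_square :: "nat \<Rightarrow> cell \<Rightarrow> nat" where
  "tensor_square 0 (i, j) = 1"
| "tensor_square (Suc k) (i, j) =
     (if i < 2 ^ k \<longleftrightarrow> j < 2 ^ k
      then tensor_square k (i mod 2 ^ k, j mod 2 ^ k) + 2 ^ k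
      else tensor_square k (i mod 2 ^ k, j mod 2 ^ k))"

lemma tensor_square_sym: "tensor_square k (i, j) = tensor_square k (j, i)"
proof (induction k arbitrary: i j)
  case (Suc k)
  show ?case using Suc[of "i mod 2 ^ k" "j mod 2 ^ k"] by (simp add: eq_commute)
qed simp

lemma tensor_square_range: "tensor_square k (i, j) \<in> {1..2 ^ k}"
proof (induction k arbitrary: i j)
  case (Suc k)
  show ?case using Suc[of "i mod 2 ^ k" "j mod 2 ^ k"] by auto
qed simp

lemma tensor_square_inj:
  "j < 2 ^ k \<Longrightarrow> j' < 2 ^ k \<Longrightarrow> tensor_square k (i, j) = tensor_square k (i, j') \<Longrightarrow> j = j'"
proof (induction k arbitrary: i j j')
  case (Suc k)
  let ?m = "2 ^ k :: nat"
  have r: "tensor_square k (i mod ?m, x) \<le> ?m" "1 \<le> tensor_square k (i mod ?m, x)" for x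
    using tensor_square_range[of k "i mod ?m" x] by auto
  have half: "j < ?m \<longleftrightarrow> j' < ?m"
    using Suc.prems(3) r[of "j mod ?m"] r[of "j' mod ?m"] by (auto split: if_splits)
  then have "tensor_square k (i mod ?m, j mod ?m) = tensor_square k (i mod ?m, j' mod ?m)"
    using Suc.prems(3) by (auto split: if_splits)
  then have eq: "j mod ?m = j' mod ?m"
    by (rule Suc.IH[rotated 2]) simp_all
  have "x div ?m = (if x < ?m then 0 else 1)" if "x < 2 ^ Suc k" for x :: nat
    using that by (simp add: le_div_geq)
  then have "j div ?m = j' div ?m"
    using half Suc.prems(1,2) by simp
  with eq show ?case
    by (metis div_mult_mod_eq)
qed simp

lemma latin_square_tensor_square: "latin_square (2 ^ k) (tensor_square k)"
proof -
  have row: "bij_betw (\<lambda>j. tensor_square k (i, j)) {..<2 ^ k} {1..2 ^ k}" for i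
  proof -
    have inj: "inj_on (\<lambda>j. tensor_square k (i, j)) {..<2 ^ k}"
      by (auto intro!: inj_onI dest: tensor_square_inj)
    have "(\<lambda>j. tensor_square k (i, j)) ` {..<2 ^ k} = {1..2 ^ k}"
      using tensor_square_range by (intro card_subset_eq) (auto simp: card_image[OF inj])
    with inj show ?thesis by (simp add: bij_betw_def)
  qed
  then show ?thesis
    unfolding latin_square_def by (subst (2) tensor_square_sym) blast
qed

end

theory Submission
  imports Defs
begin

text \<open>A cell left to First-Fit can go wrong only if some color smaller than its own occurs, among
  its neighbors, only on later cells that are also left to First-Fit. So the complement of a set
  \<open>U\<close> is a greedy defining set as soon as \<open>U\<close> contains no \<^emph>\<open>descent\<close>: three cells \<open>(i, j)\<close>,
  \<open>(i', j)\<close>, \<open>(i, j')\<close> with \<open>i < i'\<close>, \<open>j < j'\<close>, the last two carrying the same entry, smaller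
  than the first. In tensor squares a product of descent-free sets is descent-free, and \<open>L\<^sub>3\<close> has a
  descent-free set of 35 cells, found by computer search. Its powers give
  \<open>35 ^ (k div 3)\<close> cells in \<open>L\<^sub>k\<close>, which suffices because \<open>2 powr (3 * 1.673) < 35\<close>.\<close>

section \<open>Descent-free sets and First-Fit\<close>

definition descent_free :: "(cell \<Rightarrow> nat) \<Rightarrow> cell set \<Rightarrow> bool" where
  "descent_free L U \<longleftrightarrow>
     (\<forall>i j i' j'. (i, j) \<in> U \<longrightarrow> (i', j) \<in> U \<longrightarrow> (i, j') \<in> U \<longrightarrow> i < i' \<longrightarrow> j < j' \<longrightarrow>
        L (i', j) = L (i, j') \<longrightarrow> L (i, j) \<le> L (i, j'))"

lemma descent_freeD:
  assumes "descent_free L U" "(i, j) \<in> U" "(i', j) \<in> U" "(i, j') \<in> U" "i < i'" "j < j'"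
    and "L (i', j) = L (i, j')"
  shows "L (i, j) \<le> L (i, j')"
  using assms unfolding descent_free_def by blast

lemma set_lex_cells: "set (lex_cells n) = cells n"
  by (auto simp: lex_cells_def cells_def)

lemma sorted_wrt_product:
  assumes "sorted_wrt (<) xs" "sorted_wrt (<) ys"
  shows "sorted_wrt (\<lambda>u v :: nat \<times> nat. fst u < fst v \<or> fst u = fst v \<and> snd u < snd v)
    (List.product xs ys)"
  using assms by (induction xs) (auto simp: sorted_wrt_append sorted_wrt_map)

text \<open>In a strictly sorted list neither \<open>v\<close> nor anything after it can precede
  \<open>v\<close>. Hence every cell lexicographically before \<open>v\<close> has been scanned when
  First-Fit reaches \<open>v\<close>.\<close>

lemma lex_cells_prefix:
  assumes "lex_cells n = xs @ v # ys" "u \<in> cells n"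
    and "fst u < fst v \<or> fst u = fst v \<and> snd u < snd v"
  shows "u \<in> set xs"
proof -
  have "sorted_wrt (\<lambda>u v. fst u < fst v \<or> fst u = fst v \<and> snd u < snd v) (xs @ v # ys)"
    unfolding assms(1)[symmetric] lex_cells_def by (rule sorted_wrt_product) simp_all
  moreover have "u \<in> set (xs @ v # ys)"
    using assms(1,2) set_lex_cells by metis
  ultimately show ?thesis
    using assms(3) by (fastforce simp: sorted_wrt_append)
qed

lemma latin_square_adj_neq:
  assumes "latin_square n L" "u \<in> cells n" "v \<in> cells n" "rook_adj u v"
  shows "L u \<noteq> L v"
proof -
  obtain i j i' j' where uv: "u = (i, j)" "v = (i', j')"
    by (metis surj_pair)
  have "inj_on (\<lambda>j. L (i, j)) {..<n}" "inj_on (\<lambda>i. L (i, j)) {..<n}"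
    using assms unfolding latin_square_def bij_betw_def uv cells_def by auto
  then show ?thesis
    using assms unfolding uv rook_adj_def cells_def by (auto dest: inj_onD)
qed

text \<open>The restricted map is the partial coloring at the moment \<open>v\<close> is scanned.
  The color \<open>L v\<close> is available because \<open>L\<close> is Latin. A smaller available
  color would occur in the row and in the column of \<open>v\<close> only on uncolored cells; these
  lie in \<open>U\<close> and come after \<open>v\<close>, so they form a descent with
  \<open>v\<close>.\<close>

lemma first_fit_color_descent_free:
  assumes L: "latin_square n L" and U: "descent_free L U"
    and split: "lex_cells n = xs @ v # ys" and v: "v \<in> U"
  shows "first_fit_color rook_adj ((Some \<circ> L) |` (cells n - U \<union> set xs)) v = L v"
proof -
  let ?D = "cells n - U \<union> set xs"
  obtain i j where ij: "v = (i, j)" by fastforce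
  have D: "?D \<subseteq> cells n" and vn: "v \<in> cells n"
    using split set_lex_cells[of n] by auto
  then have lt: "i < n" "j < n" by (auto simp: ij cells_def)
  have row: "(\<lambda>j. L (i, j)) ` {..<n} = {1..n}" and col: "(\<lambda>i. L (i, j)) ` {..<n} = {1..n}"
    using L lt by (auto simp: latin_square_def bij_betw_def)
  have Lv: "L v \<in> {1..n}"
    using row lt ij by blast
  show ?thesis
    unfolding first_fit_color_def
  proof (rule Least_equality)
    show "1 \<le> L v \<and> (\<forall>u\<in>dom ((Some \<circ> L) |` ?D). rook_adj u v \<longrightarrow>
        ((Some \<circ> L) |` ?D) u \<noteq> Some (L v))"
      using Lv latin_square_adj_neq[OF L _ vn] D by (auto simp: restrict_map_def)
  next
    fix c
    assume c: "1 \<le> c \<and> (\<forall>u\<in>dom ((Some \<circ> L) |` ?D). rook_adj u v \<longrightarrow>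
        ((Some \<circ> L) |` ?D) u \<noteq> Some c)"
    have free: "u \<notin> ?D" if "rook_adj u v" "L u = c" for u
    proof
      assume "u \<in> ?D"
      then have "((Some \<circ> L) |` ?D) u = Some c"
        using that by simp
      then show False using c that(1) by blast
    qed
    show "L v \<le> c"
    proof (rule ccontr)
      assume less: "\<not> L v \<le> c"
      then have "c \<in> {1..n}" using c Lv by auto
      then obtain i' j' where i': "i' < n" "L (i', j) = c" and j': "j' < n" "L (i, j') = c"
        using row col by (metis (no_types, lifting) image_iff lessThan_iff)
      then have "i' \<noteq> i" "j' \<noteq> j"
        using less ij by auto
      then have *: "(i', j) \<notin> ?D" "(i, j') \<notin> ?D"
        using i' j' ij by (intro free; simp add: rook_adj_def)+
      moreover have "(i', j) \<in> cells n" "(i, j') \<in> cells n"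
        using i' j' lt by (auto simp: cells_def)
      ultimately have "(i', j) \<in> U" "(i, j') \<in> U" "\<not> i' < i" "\<not> j' < j"
        using lex_cells_prefix[OF split] ij by fastforce+
      then have "L (i, j) \<le> L (i, j')"
        using descent_freeD[OF U, of i j i' j'] v ij i' j' \<open>i' \<noteq> i\<close> \<open>j' \<noteq> j\<close> by auto
      then show False using less ij j' by simp
    qed
  qed
qed

lemma first_fit_snoc:
  "first_fit adj (xs @ [v]) p =
    (if v \<in> dom p then first_fit adj xs p
     else (first_fit adj xs p)(v \<mapsto> first_fit_color adj (first_fit adj xs p) v))"
  unfolding first_fit_def fold_append by simp

theorem greedy_defining_set_lex_descent_free:
  assumes L: "latin_square n L" and U: "descent_free L U"
  shows "greedy_defining_set_lex n L (cells n - U)"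
proof -
  let ?p = "(Some \<circ> L) |` (cells n - U)"
  \<comment> \<open>Invariant of the scan: after each prefix \<open>xs\<close> the coloring agrees
    with \<open>L\<close> on the prescribed cells and on \<open>xs\<close>, and is undefined
    elsewhere. Since the scan runs left to right, prefixes grow at their end.\<close>
  have "first_fit rook_adj xs ?p = (Some \<circ> L) |` (cells n - U \<union> set xs)"
    if "\<exists>ys. lex_cells n = xs @ ys" for xs
    using that
  proof (induction xs rule: rev_induct)
    case Nil
    show ?case by (simp add: first_fit_def)
  next
    case (snoc v xs)
    then obtain ys where ys: "lex_cells n = xs @ v # ys" by auto
    let ?f = "(Some \<circ> L) |` (cells n - U \<union> set xs)"
    have IH: "first_fit rook_adj xs ?p = ?f"
      using snoc.IH ys by blast
    have "v \<in> cells n"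
      using ys set_lex_cells[of n] by auto
    then have "v \<in> dom ?p \<longleftrightarrow> v \<notin> U"
      by (auto simp: restrict_map_def)
    then have step: "first_fit rook_adj (xs @ [v]) ?p = (if v \<in> U then ?f(v \<mapsto> L v) else ?f)"
      unfolding first_fit_snoc IH using first_fit_color_descent_free[OF L U ys] by presburger
    show ?case
    proof (cases "v \<in> U")
      case True
      have "(Some \<circ> L) |` (cells n - U \<union> set (xs @ [v])) = ?f(v \<mapsto> L v)"
        by (auto simp: fun_eq_iff restrict_map_def)
      then show ?thesis using step True by presburger
    next
      case False
      then have "cells n - U \<union> set (xs @ [v]) = cells n - U \<union> set xs"
        using \<open>v \<in> cells n\<close> by auto
      then show ?thesis using step False by presburger
    qed
  qed
  from this[of "lex_cells n"] show ?thesis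
    by (auto simp: greedy_defining_set_lex_def set_lex_cells restrict_map_def)
qed

section \<open>Products of descent-free sets in tensor squares\<close>

text \<open>Peeling off the top \<open>m\<close> binary digits of the indices exhibits the square as
  a tensor product with outer factor of order \<open>2 ^ m\<close>. Entries start at 1, so the outer
  one is shifted down to serve as a leading digit.\<close>

lemma tensor_square_add:
  assumes "i < 2 ^ (k + m)" "j < 2 ^ (k + m)"
  shows "tensor_square (k + m) (i, j) =
    (tensor_square m (i div 2 ^ k, j div 2 ^ k) - 1) * 2 ^ k +
    tensor_square k (i mod 2 ^ k, j mod 2 ^ k)"
  using assms
proof (induction m arbitrary: i j)
  case 0
  then show ?case by simp
next
  case (Suc m)
  have lt: "x < 2 ^ (k + m) \<longleftrightarrow> x div 2 ^ k < 2 ^ m" for x :: nat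
    by (simp add: power_add div_less_iff_less_mult mult.commute)
  have md: "x mod 2 ^ (k + m) div 2 ^ k = x div 2 ^ k mod 2 ^ m" for x :: nat
    by (simp add: power_add mod_mult2_eq)
  have mm: "x mod 2 ^ (k + m) mod 2 ^ k = x mod 2 ^ k" for x :: nat
    by (simp add: power_add mod_mult2_eq)
  let ?a = "tensor_square m (i div 2 ^ k mod 2 ^ m, j div 2 ^ k mod 2 ^ m)"
  have IH: "tensor_square (k + m) (i mod 2 ^ (k + m), j mod 2 ^ (k + m)) =
      (?a - 1) * 2 ^ k + tensor_square k (i mod 2 ^ k, j mod 2 ^ k)"
    using Suc.IH[of "i mod 2 ^ (k + m)" "j mod 2 ^ (k + m)"] by (simp add: md mm)
  \<comment> \<open>The increment for agreeing top digits passes from the outer factor to the whole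
    square; \<open>?a \<ge> 1\<close> keeps the truncated subtraction exact.\<close>
  have "(?a + 2 ^ m - 1) * 2 ^ k = (?a - 1) * 2 ^ k + 2 ^ (k + m)"
    using tensor_square_range[of m "i div 2 ^ k mod 2 ^ m" "j div 2 ^ k mod 2 ^ m"]
    by (cases ?a) (auto simp: power_add algebra_simps)
  then show ?case
    using IH by (simp add: lt)
qed

definition block_product :: "nat \<Rightarrow> cell set \<Rightarrow> cell set \<Rightarrow> cell set" where
  "block_product n A B = {(i, j). (i div n, j div n) \<in> A \<and> (i mod n, j mod n) \<in> B}"

lemma block_product_subset_cells:
  assumes "A \<subseteq> cells m" "B \<subseteq> cells n"
  shows "block_product n A B \<subseteq> cells (n * m)"
proof (cases "n = 0")
  case False
  then show ?thesis
    using assms by (auto simp: block_product_def cells_def div_less_iff_less_mult mult.commute)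
qed (use assms in \<open>auto simp: block_product_def cells_def\<close>)

lemma card_block_product:
  assumes "B \<subseteq> cells n"
  shows "card (block_product n A B) = card A * card B"
proof -
  have "bij_betw (\<lambda>((a, b), (c, d)). (a * n + c, b * n + d)) (A \<times> B) (block_product n A B)"
    by (rule bij_betw_byWitness[where
          f' = "\<lambda>(i, j). ((i div n, j div n), (i mod n, j mod n))"])
      (use assms in \<open>auto simp: block_product_def cells_def\<close>)
  then show ?thesis
    by (metis bij_betw_same_card card_cartesian_product)
qed

text \<open>Leading value \<open>a\<close> covers the interval from \<open>(a - 1) * n + 1\<close>
  to \<open>a * n\<close>. These intervals are disjoint and increase with \<open>a\<close>, so the
  comparison is lexicographic.\<close>

lemma block_value_less_iff:
  fixes a b c d n :: nat
  assumes "1 \<le> a" "1 \<le> b" "c \<in> {1..n}" "d \<in> {1..n}"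
  shows "(a - 1) * n + c < (b - 1) * n + d \<longleftrightarrow> a < b \<or> a = b \<and> c < d"
proof -
  have *: "(x - 1) * n + e < (y - 1) * n + f"
    if "1 \<le> x" "x < y" "e \<in> {1..n}" "f \<in> {1..n}" for x y e f :: nat
  proof -
    have "(x - 1) * n + e \<le> x * n"
      using that by (cases x) auto
    also have "\<dots> \<le> (y - 1) * n"
      using that by (intro mult_right_mono) auto
    finally show ?thesis using that by simp
  qed
  show ?thesis
    using *[of a b c d] *[of b a d c] assms by (cases a b rule: linorder_cases) auto
qed

lemma tensor_square_inj_row:
  "i < 2 ^ k \<Longrightarrow> i' < 2 ^ k \<Longrightarrow> tensor_square k (i, j) = tensor_square k (i', j) \<Longrightarrow> i = i'"
  by (metis tensor_square_inj tensor_square_sym)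

text \<open>If two of the block rows or two of the block columns of a descent coincide, the Latin
  property of the outer square puts all three cells into one block, and their remainders form a
  descent in \<open>B\<close>. Otherwise the quotients are strictly ordered, and \<open>A\<close>
  excludes the descent.\<close>

lemma descent_free_block_product:
  assumes A: "descent_free (tensor_square m) A" "A \<subseteq> cells (2 ^ m)"
    and B: "descent_free (tensor_square k) B" "B \<subseteq> cells (2 ^ k)"
  shows "descent_free (tensor_square (k + m)) (block_product (2 ^ k) A B)"
  unfolding descent_free_def
proof (intro allI impI, rule ccontr)
  fix i j i' j'
  let ?P = "block_product (2 ^ k) A B" and ?T = "tensor_square (k + m)"
  let ?q = "\<lambda>x :: nat. x div 2 ^ k" and ?r = "\<lambda>x :: nat. x mod 2 ^ k"
  let ?Q = "\<lambda>x y. tensor_square m (?q x, ?q y)" and ?R = "\<lambda>x y. tensor_square k (?r x, ?r y)"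
  assume P: "(i, j) \<in> ?P" "(i', j) \<in> ?P" "(i, j') \<in> ?P" and lt: "i < i'" "j < j'"
    and eq: "?T (i', j) = ?T (i, j')" and "\<not> ?T (i, j) \<le> ?T (i, j')"
  then have less: "?T (i, j') < ?T (i, j)" by simp
  have AB: "(?q i, ?q j) \<in> A" "(?q i', ?q j) \<in> A" "(?q i, ?q j') \<in> A"
    "(?r i, ?r j) \<in> B" "(?r i', ?r j) \<in> B" "(?r i, ?r j') \<in> B"
    using P by (auto simp: block_product_def)
  have qlt: "?q i < 2 ^ m" "?q i' < 2 ^ m" "?q j < 2 ^ m" "?q j' < 2 ^ m"
    using AB A(2) by (auto simp: cells_def)
  have lts: "i < 2 ^ (k + m)" "i' < 2 ^ (k + m)" "j < 2 ^ (k + m)" "j' < 2 ^ (k + m)"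
    using P block_product_subset_cells[OF A(2) B(2)] by (auto simp: cells_def power_add)
  have range: "1 \<le> ?Q x y" "?R x y \<in> {1..2 ^ k}" for x y
    using tensor_square_range[of m "?q x" "?q y"] tensor_square_range[of k "?r x" "?r y"] by auto
  have T: "?T (x, y) < ?T (x', y') \<longleftrightarrow> ?Q x y < ?Q x' y' \<or> ?Q x y = ?Q x' y' \<and> ?R x y < ?R x' y'"
    if "x < 2 ^ (k + m)" "y < 2 ^ (k + m)" "x' < 2 ^ (k + m)" "y' < 2 ^ (k + m)" for x y x' y'
    by (simp only: tensor_square_add that block_value_less_iff range)
  \<comment> \<open>Equality is split into two failed comparisons so that the lexicographic rule
    \<open>T\<close> yields equality of both components.\<close>
  have "\<not> ?T (i', j) < ?T (i, j')" "\<not> ?T (i, j') < ?T (i', j)"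
    using eq by simp_all
  then have Qeq: "?Q i' j = ?Q i j'" and Req: "?R i' j = ?R i j'"
    using lts by (auto simp: T)
  have le: "?q i \<le> ?q i'" "?q j \<le> ?q j'"
    using lt by (simp_all add: div_le_mono)
  show False
  proof (cases "?q i = ?q i' \<or> ?q j = ?q j'")
    case True
    then have q: "?q i = ?q i' \<and> ?q j = ?q j'"
    proof
      assume "?q i = ?q i'"
      moreover from this have "?q j = ?q j'"
        using Qeq by (intro tensor_square_inj[OF qlt(3,4)]) simp
      ultimately show ?thesis ..
    next
      assume "?q j = ?q j'"
      moreover from this have "?q i = ?q i'"
        using Qeq by (intro tensor_square_inj_row[OF qlt(1,2), of "?q j"]) simp
      ultimately show ?thesis by simp
    qed
    then have "?r i < ?r i'" "?r j < ?r j'"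
      using lt by (metis div_mult_mod_eq nat_add_left_cancel_less)+
    then have "?R i j \<le> ?R i j'"
      using descent_freeD[OF B(1)] AB Req by blast
    then show False
      using less lts q by (simp add: T)
  next
    case False
    then have "?Q i j \<le> ?Q i j'"
      using descent_freeD[OF A(1)] AB Qeq le by (metis nat_less_le)
    \<comment> \<open>Strictness is needed here: with equal outer entries the remainders would
      decide the comparison.\<close>
    moreover have "?Q i j \<noteq> ?Q i j'"
      using False tensor_square_inj[OF qlt(3,4)] by blast
    ultimately show False
      using less lts by (simp add: T)
  qed
qed

section \<open>A base set in order 8, its powers and the count\<close>

definition base_cells :: "cell list" where
  "base_cells =
    [(0, 0), (0, 1), (0, 4), (0, 5),
     (1, 1), (1, 3), (1, 5), (1, 6),
     (2, 0), (2, 1), (2, 2), (2, 3), (2, 6),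
     (3, 4), (3, 5), (3, 6), (3, 7),
     (4, 2), (4, 4), (4, 6),
     (5, 2), (5, 3), (5, 6), (5, 7),
     (6, 0), (6, 3), (6, 5), (6, 6), (6, 7),
     (7, 0), (7, 1), (7, 2), (7, 4), (7, 5), (7, 7)]"

lemma base_cells_subset: "set base_cells \<subseteq> cells (2 ^ 3)"
  by (simp add: base_cells_def cells_def)

lemma card_base_cells: "card (set base_cells) = 35"
  by (simp add: base_cells_def)

text \<open>Each binary digit on which the indices agree contributes its weight; for indices below 8
  the entry is 8 minus their bitwise exclusive or.\<close>

lemma tensor_square_3:
  "tensor_square 3 (i, j) =
    (if i < 4 \<longleftrightarrow> j < 4 then 4 else 0) +
    (if i mod 4 < 2 \<longleftrightarrow> j mod 4 < 2 then 2 else 0) +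
    (if i mod 4 mod 2 < 1 \<longleftrightarrow> j mod 4 mod 2 < 1 then 1 else 0) + 1"
  by (auto simp: numeral_3_eq_3)

lemma descent_free_base_cells: "descent_free (tensor_square 3) (set base_cells)"
  unfolding descent_free_def
proof (intro allI impI)
  fix i j i' j'
  assume u: "(i, j) \<in> set base_cells" and vw: "(i', j) \<in> set base_cells" "(i, j') \<in> set base_cells"
    and lt: "i < i'" "j < j'" and eq: "tensor_square 3 (i', j) = tensor_square 3 (i, j')"
  from u[unfolded base_cells_def, simplified] vw lt eq
  show "tensor_square 3 (i, j) \<le> tensor_square 3 (i, j')"
    \<comment> \<open>Finite check over the 35 choices of the corner \<open>(i, j)\<close>. Fixing
      the corner before unfolding the other two memberships leaves only cells of its column and
      row.\<close>
    by (elim disjE conjE; hypsubst; auto simp: base_cells_def; simp add: tensor_square_3)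
qed

text \<open>Levels are consumed in threes; the remaining zero, one or two levels keep a single cell,
  which costs only a constant factor.\<close>

fun free_cells :: "nat \<Rightarrow> cell set" where
  "free_cells (Suc (Suc (Suc k))) = block_product (2 ^ k) (set base_cells) (free_cells k)"
| "free_cells _ = {(0, 0)}"

lemma free_cells_subset: "free_cells k \<subseteq> cells (2 ^ k)"
proof (induction k rule: free_cells.induct)
  case (1 k)
  then show ?case
    using block_product_subset_cells[OF base_cells_subset, of "free_cells k" "2 ^ k"]
    by (simp add: mult.commute)
qed (simp_all add: cells_def)

lemma descent_free_free_cells: "descent_free (tensor_square k) (free_cells k)"
proof (induction k rule: free_cells.induct)
  case (1 k)
  then show ?case
    using descent_free_block_product[OF descent_free_base_cells base_cells_subset 1
        free_cells_subset]
    by (simp add: numeral_3_eq_3)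
qed (simp_all add: descent_free_def)

lemma card_free_cells: "card (free_cells k) = 35 ^ (k div 3)"
proof (induction k rule: free_cells.induct)
  case (1 k)
  have "Suc (Suc (Suc k)) div 3 = Suc (k div 3)" by simp
  then show ?case
    using 1 by (simp add: card_block_product free_cells_subset card_base_cells)
qed simp_all

lemma card_free_cells_ge: "real (2 ^ k) powr 1.673 \<le> 64 * real (card (free_cells k))"
proof -
  let ?q = "k div 3"
  \<comment> \<open>The exponent 5.1 lies between \<open>3 * 1.673 = 5.019\<close> and the binary
    logarithm of 35. Tenth powers make the comparison with 35 an integer one.\<close>
  have "((2 :: real) powr 5.1) ^ 10 = 2 ^ 51"
    by (simp add: powr_power)
  also have "\<dots> \<le> 35 ^ 10"
    by simp
  finally have base: "(2 :: real) powr 5.1 \<le> 35"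
    by (rule power_le_imp_le_base[where n = 9, simplified]) simp
  have "real k \<le> 3 * real ?q + 2"
    by linarith
  \<comment> \<open>The at most two leftover levels add at most \<open>2 * 1.673 < 6\<close>, whence
    the factor \<open>64 = 2 ^ 6\<close>.\<close>
  then have "real k * 1.673 \<le> 5.1 * real ?q + 6"
    by simp
  have "real (2 ^ k) powr 1.673 = (2 powr real k) powr 1.673"
    by (simp add: powr_realpow)
  also have "\<dots> = 2 powr (real k * 1.673)"
    by (rule powr_powr)
  also have "\<dots> \<le> 2 powr (5.1 * real ?q + 6)"
    using \<open>real k * 1.673 \<le> _\<close> by (intro powr_mono) simp_all
  also have "\<dots> = 64 * (2 powr 5.1) ^ ?q"
    by (simp add: powr_add powr_power mult.commute)
  also have "\<dots> \<le> 64 * 35 ^ ?q"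
    using base by (intro mult_left_mono power_mono) simp_all
  finally show ?thesis
    by (simp add: card_free_cells)
qed

theorem theorem12:
  shows "\<exists>S :: nat \<Rightarrow> cell set.
    (\<forall>k. greedy_defining_set_lex (2 ^ k) (tensor_square k) (S k)) \<and>
    (\<lambda>k. (real (2 ^ k))\<^sup>2 - real (card (S k))) \<in> \<Omega>(\<lambda>k. real (2 ^ k) powr 1.673)"
proof (intro exI conjI allI)
  let ?S = "\<lambda>k. cells (2 ^ k) - free_cells k"
  show "greedy_defining_set_lex (2 ^ k) (tensor_square k) (?S k)" for k
    by (rule greedy_defining_set_lex_descent_free[OF latin_square_tensor_square
          descent_free_free_cells])
  have eq: "(real (2 ^ k))\<^sup>2 - real (card (?S k)) = real (card (free_cells k))" for k
  proof -
    have fin: "finite (cells (2 ^ k))" and card: "card (cells (2 ^ k)) = (2 ^ k)\<^sup>2"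
      by (simp_all add: cells_def power2_eq_square)
    have "card (?S k) = card (cells (2 ^ k)) - card (free_cells k)"
      using free_cells_subset finite_subset[OF _ fin] by (intro card_Diff_subset) auto
    \<comment> \<open>Ensures that the subtraction of cardinalities is not truncated when it is read
      over the reals.\<close>
    moreover have "card (free_cells k) \<le> card (cells (2 ^ k))"
      using free_cells_subset fin by (rule card_mono[rotated])
    ultimately show ?thesis
      by (simp add: card)
  qed
  show "(\<lambda>k. (real (2 ^ k))\<^sup>2 - real (card (?S k))) \<in> \<Omega>(\<lambda>k. real (2 ^ k) powr 1.673)"
    unfolding eq
    by (rule landau_omega.bigI[of "1 / 64"]) (use card_free_cells_ge in \<open>simp_all add: field_simps\<close>)
qed

end
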